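(* Every ideal $I\subset\mathbb{C}[x_1,\ldots,x_n]$ has a tropical basis, i.e. there is a finite set $\{f_1,\ldots,f_t\}$ of polynomials such that $\langle f_1,\ldots,f_t\rangle=I$ and $\mathcal{T}(I)=\mathcal{T}(f_1)\cap\cdots\cap\mathcal{T}(f_t)$.
   Context: For $f\in\mathbb{C}[x_1,\ldots,x_n]$ and $w\in\mathbb{R}^n$, the initial form $\mathrm{in}_w(f)$ is the sum of all terms $c\,x^u$ of $f$ of lowest $w$-weight $w\cdot u$ (and $\mathrm{in}_w(0)=0$). A monomial here means a single term, up to a nonzero scalar. The tropical hypersurface of $f$ is $\mathcal{T}(f)=\{w\in\mathbb{R}^n:\mathrm{in}_w(f)\text{ is not a monomial}\}$. For an ideal $I$, the tropical variety is $\mathcal{T}(I)=\bigcap_{f\in I}\mathcal{T}(f)$. *)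

theory Defs
  imports "HOL-Analysis.Analysis" "HOL-Library.Poly_Mapping"
begin

text \<open>
  Polynomials in variables indexed by a finite type \<open>'n\<close>: an exponent vector is a finitely
  supported map \<open>'n \<Rightarrow>\<^sub>0 nat\<close>, a polynomial is a finitely supported map from exponent vectors to
  coefficients, and multiplication is the convolution product of \<open>HOL-Library.Poly_Mapping\<close>.
\<close>

type_synonym 'n cpoly = "('n \<Rightarrow>\<^sub>0 nat) \<Rightarrow>\<^sub>0 complex"

text \<open>
  Ideals of a commutative ring are the submodules of the ring regarded as a module over itself,
  and the ideal generated by a set is its span in that module.
\<close>

lemma module_times: "module ((*) :: 'a::comm_ring_1 \<Rightarrow> 'a \<Rightarrow> 'a)"
  by unfold_locales (simp_all add: algebra_simps)

definition is_ideal :: "'a::comm_ring_1 set \<Rightarrow> bool"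
  where "is_ideal I \<longleftrightarrow> module.subspace (*) I"

definition ideal_generated_by :: "'a::comm_ring_1 set \<Rightarrow> 'a set"
  where "ideal_generated_by F = module.span (*) F"

lemma is_ideal_iff:
  "is_ideal I \<longleftrightarrow> 0 \<in> I \<and> (\<forall>a\<in>I. \<forall>b\<in>I. a + b \<in> I) \<and> (\<forall>r. \<forall>a\<in>I. r * a \<in> I)"
  unfolding is_ideal_def module.subspace_def[OF module_times] by blast

lemma ideal_generated_by_explicit:
  "ideal_generated_by F = {\<Sum>f\<in>G. r f * f | G r. finite G \<and> G \<subseteq> F}"
  unfolding ideal_generated_by_def by (rule module.span_explicit[OF module_times])

definition weight :: "real ^ 'n::finite \<Rightarrow> ('n \<Rightarrow>\<^sub>0 nat) \<Rightarrow> real"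
  where "weight w u = w \<bullet> (\<chi> i. real (Poly_Mapping.lookup u i))"

text \<open>For \<open>f = 0\<close> the sum is empty, so the initial form of \<open>0\<close> is \<open>0\<close>.\<close>

definition initial_form :: "real ^ 'n::finite \<Rightarrow> 'n cpoly \<Rightarrow> 'n cpoly"
  where "initial_form w f =
    (\<Sum>u \<in> {u \<in> Poly_Mapping.keys f. \<forall>v \<in> Poly_Mapping.keys f. weight w u \<le> weight w v}.
       Poly_Mapping.single u (Poly_Mapping.lookup f u))"

text \<open>A monomial is a single nonzero term; in particular \<open>0\<close> is not a monomial.\<close>

definition is_monomial :: "'n cpoly \<Rightarrow> bool"
  where "is_monomial f \<longleftrightarrow> (\<exists>u c. c \<noteq> 0 \<and> f = Poly_Mapping.single u c)"

definition tropical_hypersurface :: "'n::finite cpoly \<Rightarrow> (real ^ 'n) set"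
  where "tropical_hypersurface f = {w. \<not> is_monomial (initial_form w f)}"

definition tropical_variety :: "'n::finite cpoly set \<Rightarrow> (real ^ 'n) set"
  where "tropical_variety I = (\<Inter>f\<in>I. tropical_hypersurface f)"

text \<open>
  For \<open>F = {}\<close>, which generates the zero ideal, the intersection over \<open>F\<close> is the whole space.
\<close>

definition is_tropical_basis :: "'n::finite cpoly set \<Rightarrow> 'n cpoly set \<Rightarrow> bool"
  where "is_tropical_basis F I \<longleftrightarrow>
    finite F \<and> ideal_generated_by F = I \<and>
    tropical_variety I = (\<Inter>f\<in>F. tropical_hypersurface f)"

end

theory Submission
  imports Defs
begin

text \<open>
  Call a set \<open>W\<close> of weights bad if no finite subset of \<open>I\<close> witnesses that the points of \<open>W\<close> outside
  the tropical variety are outside. A bad set cut into finitely many pieces has a bad piece. For bad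
  \<open>W\<close>, consider for every degree bound \<open>d\<close> the span \<open>J\<^sub>d(W)\<close> of the initial forms of those
  \<open>f \<in> I\<close> of degree at most \<open>d\<close> whose initial form is the same for all weights in \<open>W\<close>. These
  spans grow as \<open>W\<close> shrinks and behave like an ideal in one more variable, so they satisfy the
  ascending chain condition, and there is a bad \<open>W\<close> for which they no longer change on bad subsets.
  Cutting \<open>W\<close> according to the order in which the weights sort the exponents of degree at most
  \<open>d\<close> yields a bad piece \<open>Z\<close> on which all initial forms of degree at most \<open>d\<close> are constant, so that
  \<open>J\<^sub>d(W) = J\<^sub>d(Z)\<close> contains every such initial form at points of \<open>Z\<close>, and then, by a dimension
  count, at all points of \<open>W\<close>. Hence if some \<open>f \<in> I\<close> has a monomial as its initial form at a point
  of \<open>W\<close>, this monomial lies in \<open>J\<^sub>d(Z)\<close>, and a single element of \<open>I\<close> has it as initial form on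
  all of \<open>Z\<close>, which contradicts badness of \<open>Z\<close>.
\<close>

subsection \<open>Initial forms\<close>

text \<open>Scalars act as constant polynomials, so closure of an ideal under products already gives
  closure under scalars.\<close>

abbreviation cscale :: "complex \<Rightarrow> 'n cpoly \<Rightarrow> 'n cpoly"
  where "cscale c f \<equiv> Poly_Mapping.single 0 c * f"

lemma lookup_single_times:
  fixes f :: "'n cpoly"
  shows "Poly_Mapping.lookup (Poly_Mapping.single v c * f) (v + u) = c * Poly_Mapping.lookup f u"
  by (simp add: lookup_mult lookup_single when_mult)

lemma lookup_single_times_eq_0:
  fixes f :: "'n cpoly"
  assumes "\<And>u. k \<noteq> v + u"
  shows "Poly_Mapping.lookup (Poly_Mapping.single v c * f) k = 0"
  using assms by (simp add: lookup_mult lookup_single when_mult)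

lemma lookup_cscale [simp]:
  "Poly_Mapping.lookup (cscale c f) u = c * Poly_Mapping.lookup f u"
  using lookup_single_times[of 0 c f u] by simp

interpretation cpoly: vector_space "cscale :: complex \<Rightarrow> 'n cpoly \<Rightarrow> 'n cpoly"
  by unfold_locales (simp_all add: algebra_simps single_add mult_single flip: mult.assoc)

lemma weight_add: "weight w (u + v) = weight w u + weight w v"
  by (simp add: weight_def inner_vec_def lookup_add algebra_simps sum.distrib)

text \<open>Unlike \<open>initial_form\<close>, this component is linear in \<open>f\<close> once
  \<open>m\<close> is fixed, so arguments about spans run through it.\<close>

definition weight_part :: "real ^ 'n::finite \<Rightarrow> real \<Rightarrow> 'n cpoly \<Rightarrow> 'n cpoly"
  where "weight_part w m f = Poly_Mapping.mapp (\<lambda>u c. if weight w u = m then c else 0) f"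

lemma lookup_weight_part [simp]:
  "Poly_Mapping.lookup (weight_part w m f) u = (if weight w u = m then Poly_Mapping.lookup f u else 0)"
  by (auto simp: weight_part_def lookup_mapp in_keys_iff when_def)

lemma weight_part_add: "weight_part w m (f + g) = weight_part w m f + weight_part w m g"
  by (rule poly_mapping_eqI) (simp add: lookup_add)

lemma weight_part_cscale: "weight_part w m (cscale c f) = cscale c (weight_part w m f)"
  by (rule poly_mapping_eqI) simp

lemma weight_part_0 [simp]: "weight_part w m 0 = 0"
  by (rule poly_mapping_eqI) simp

lemma weight_part_sum: "weight_part w m (\<Sum>i\<in>A. f i) = (\<Sum>i\<in>A. weight_part w m (f i))"
  by (rule poly_mapping_eqI) (simp add: lookup_sum)

lemma weight_part_weight_part:
  "weight_part w m (weight_part w m' f) = (if m = m' then weight_part w m f else 0)"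
  by (rule poly_mapping_eqI) simp

lemma lookup_initial_form:
  "Poly_Mapping.lookup (initial_form w f) u =
    (if \<forall>v\<in>Poly_Mapping.keys f. weight w u \<le> weight w v then Poly_Mapping.lookup f u else 0)"
proof -
  let ?M = "{u \<in> Poly_Mapping.keys f. \<forall>v \<in> Poly_Mapping.keys f. weight w u \<le> weight w v}"
  have "finite ?M" by simp
  then show ?thesis
    by (auto simp: initial_form_def lookup_sum lookup_single when_def in_keys_iff)
qed

lemma keys_initial_form: "Poly_Mapping.keys (initial_form w f) \<subseteq> Poly_Mapping.keys f"
  by (auto simp: in_keys_iff lookup_initial_form split: if_splits)

lemma initial_form_0 [simp]: "initial_form w 0 = 0"
  by (rule poly_mapping_eqI) (simp add: lookup_initial_form)

text \<open>Nonvanishing forces the lower bound \<open>m\<close> to be attained, so it is the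
  minimal weight.\<close>

lemma initial_form_eq_weight_part:
  assumes "\<forall>u\<in>Poly_Mapping.keys f. m \<le> weight w u" "weight_part w m f \<noteq> 0"
  shows "initial_form w f = weight_part w m f"
proof (rule poly_mapping_eqI)
  fix u
  obtain v where "weight w v = m" "v \<in> Poly_Mapping.keys f"
    using assms(2) by (metis lookup_weight_part lookup_zero poly_mapping_eqI in_keys_iff)
  then have "(\<forall>v\<in>Poly_Mapping.keys f. weight w u \<le> weight w v) \<longleftrightarrow> weight w u = m"
    if "u \<in> Poly_Mapping.keys f"
    using assms(1) that by force
  then show "Poly_Mapping.lookup (initial_form w f) u = Poly_Mapping.lookup (weight_part w m f) u"
    by (auto simp: lookup_initial_form in_keys_iff)
qed

lemma minimal_weight_part:
  assumes "f \<noteq> 0"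
  obtains m where "\<forall>u\<in>Poly_Mapping.keys f. m \<le> weight w u" "weight_part w m f \<noteq> 0"
    "initial_form w f = weight_part w m f"
proof -
  let ?K = "weight w ` Poly_Mapping.keys f"
  have K: "finite ?K" "?K \<noteq> {}" using assms by auto
  have min: "\<forall>u\<in>Poly_Mapping.keys f. Min ?K \<le> weight w u" by simp
  obtain v where v: "v \<in> Poly_Mapping.keys f" "weight w v = Min ?K"
    using Min_in[OF K] by (metis imageE)
  then have "Poly_Mapping.lookup (weight_part w (Min ?K) f) v \<noteq> 0" by (simp add: in_keys_iff)
  then have "weight_part w (Min ?K) f \<noteq> 0" by (metis lookup_zero)
  then show thesis using that min initial_form_eq_weight_part by blast
qed

lemma initial_form_single_times:
  "initial_form w (Poly_Mapping.single v 1 * f) = Poly_Mapping.single v 1 * initial_form w f"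
proof (rule poly_mapping_eqI)
  fix k
  have keys: "Poly_Mapping.keys (Poly_Mapping.single v 1 * f) = (+) v ` Poly_Mapping.keys f"
    by (auto simp: in_keys_iff lookup_single_times)
       (metis image_eqI in_keys_iff lookup_single_times lookup_single_times_eq_0 mult_1)
  show "Poly_Mapping.lookup (initial_form w (Poly_Mapping.single v 1 * f)) k
      = Poly_Mapping.lookup (Poly_Mapping.single v 1 * initial_form w f) k"
  proof (cases "\<exists>u. k = v + u")
    case True
    then show ?thesis
      by (auto simp: lookup_initial_form keys lookup_single_times weight_add)
  next
    case False
    then show ?thesis by (simp add: lookup_initial_form lookup_single_times_eq_0)
  qed
qed

text \<open>Taking initial forms is not additive, but each one is homogeneous in weight. In a
  combination giving \<open>x\<close>, only summands of weight \<open>m\<close> matter: their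
  preimages in \<open>G\<close> make up \<open>h\<close>, the others are dropped.\<close>

lemma lift_initial_form_span:
  assumes "x \<in> cpoly.span (initial_form w ` G)"
  shows "\<exists>h\<in>cpoly.span G. (\<forall>u\<in>Poly_Mapping.keys h. m \<le> weight w u)
    \<and> weight_part w m h = weight_part w m x"
  using assms
proof (induct rule: cpoly.span_induct_alt)
  case base
  show ?case by (intro bexI[of _ 0]) (simp_all add: cpoly.span_zero)
next
  case (step c x y)
  then obtain f h where f: "f \<in> G" "x = initial_form w f" and h: "h \<in> cpoly.span G"
    "\<forall>u\<in>Poly_Mapping.keys h. m \<le> weight w u" "weight_part w m h = weight_part w m y" by auto
  show ?case
  proof (cases "weight_part w m x = 0")
    case True
    then show ?thesis using h by (auto simp: weight_part_add weight_part_cscale)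
  next
    case False
    then have "f \<noteq> 0" using f by auto
    then obtain m' where m': "\<forall>u\<in>Poly_Mapping.keys f. m' \<le> weight w u" "x = weight_part w m' f"
      using minimal_weight_part f(2) by metis
    then have "m' = m" using False by (auto simp: weight_part_weight_part split: if_splits)
    then have "\<forall>u\<in>Poly_Mapping.keys (cscale c f + h). m \<le> weight w u"
      using m'(1) h(2) by (fastforce simp: in_keys_iff lookup_add)
    moreover have "cscale c f + h \<in> cpoly.span G"
      using f h by (intro cpoly.span_add cpoly.span_scale) (auto intro: cpoly.span_base)
    moreover have "weight_part w m (cscale c f + h) = weight_part w m (cscale c x + y)"
      using h m' \<open>m' = m\<close> by (simp add: weight_part_add weight_part_cscale weight_part_weight_part)
    ultimately show ?thesis by blast
  qed
qed

text \<open>Division: subtracting an element of the span of \<open>G\<close> with the same lowest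
  part raises the minimal weight, and only finitely many weights occur on \<open>S\<close>.\<close>

lemma subset_span_if_initial_forms_in_span:
  assumes V: "cpoly.subspace V" "\<forall>f\<in>V. Poly_Mapping.keys f \<subseteq> S" and "finite S" "G \<subseteq> V"
    and ini: "\<forall>f\<in>V. initial_form w f \<in> cpoly.span (initial_form w ` G)"
  shows "V \<subseteq> cpoly.span G"
proof
  fix f assume "f \<in> V"
  then show "f \<in> cpoly.span G"
  \<comment> \<open>For nonzero \<open>f\<close> this counts the exponents in \<open>S\<close> whose
    weight is at least the minimal weight of \<open>f\<close>.\<close>
  proof (induct "card {u \<in> S. \<exists>v\<in>Poly_Mapping.keys f. weight w v \<le> weight w u}"
      arbitrary: f rule: less_induct)
    case less
    show ?case
    proof (cases "f = 0")
      case True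
      then show ?thesis by (simp add: cpoly.span_zero)
    next
      case False
      then obtain m where m: "\<forall>u\<in>Poly_Mapping.keys f. m \<le> weight w u" "weight_part w m f \<noteq> 0"
        "initial_form w f = weight_part w m f" by (rule minimal_weight_part)
      have "weight_part w m f \<in> cpoly.span (initial_form w ` G)" using less.prems ini m(3) by metis
      from lift_initial_form_span[OF this, of m] obtain h where h: "h \<in> cpoly.span G"
        "\<forall>u\<in>Poly_Mapping.keys h. m \<le> weight w u" "weight_part w m h = weight_part w m f"
        by (auto simp: weight_part_weight_part)
      have "h \<in> V" using h(1) cpoly.span_minimal[OF \<open>G \<subseteq> V\<close> V(1)] by blast
      then have fh: "f - h \<in> V" using less.prems V(1) cpoly.subspace_diff by blast
      have gt: "m < weight w u" if u: "u \<in> Poly_Mapping.keys (f - h)" for u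
      proof -
        have "m \<le> weight w u"
          using u m(1) h(2) by (fastforce simp: in_keys_iff lookup_minus)
        moreover have "weight w u \<noteq> m"
          using u h(3) by (auto simp: in_keys_iff lookup_minus) (metis lookup_weight_part)
        ultimately show ?thesis by simp
      qed
      obtain v where v: "weight w v = m" "v \<in> Poly_Mapping.keys f"
        using m(2) by (metis lookup_weight_part lookup_zero poly_mapping_eqI in_keys_iff)
      let ?U = "\<lambda>g. {u \<in> S. \<exists>v\<in>Poly_Mapping.keys g. weight w v \<le> weight w u}"
      have U: "m < weight w u" if "u \<in> ?U (f - h)" for u
        using that gt by fastforce
      have "?U (f - h) \<subset> ?U f"
      proof (rule psubsetI)
        show "?U (f - h) \<subseteq> ?U f"
        proof
          fix u assume u: "u \<in> ?U (f - h)"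
          then have "weight w v \<le> weight w u" using U v(1) by (simp add: less_imp_le)
          then show "u \<in> ?U f" using u v(2) by blast
        qed
        have "v \<in> ?U f" using v V(2) less.prems by blast
        moreover have "v \<notin> ?U (f - h)" using U v(1) by blast
        ultimately show "?U (f - h) \<noteq> ?U f" by blast
      qed
      then have "f - h \<in> cpoly.span G"
        using fh \<open>finite S\<close> by (intro less.hyps psubset_card_mono) auto
      then show ?thesis using h(1) cpoly.span_add by fastforce
    qed
  qed
qed

text \<open>
  In finite dimensions this is a dimension count: the initial forms of \<open>V\<close> at \<open>w\<close> span a space that
  contains the span of the initial forms of \<open>D\<close>, and both have the dimension of \<open>V\<close>. The proof avoids
  dimensions: choose \<open>G \<subseteq> D\<close> with linearly independent initial forms; then \<open>G\<close> spans \<open>V\<close>, and no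
  cancellation of lowest terms at \<open>w\<close> is possible in a linear combination of \<open>G\<close>.
\<close>

lemma initial_form_in_span_transfer:
  assumes V: "cpoly.subspace V" "\<forall>f\<in>V. Poly_Mapping.keys f \<subseteq> S" and "finite S" "D \<subseteq> V"
    and eq: "\<forall>f\<in>D. initial_form w f = initial_form w' f"
    and ini: "\<forall>f\<in>V. initial_form w' f \<in> cpoly.span (initial_form w' ` D)"
    and "f \<in> V"
  shows "initial_form w f \<in> cpoly.span (initial_form w ` D)"
proof (cases "f = 0")
  case True
  then show ?thesis by (simp add: cpoly.span_zero)
next
  case False
  obtain B where B: "B \<subseteq> initial_form w' ` D" "cpoly.independent B"
    "initial_form w' ` D \<subseteq> cpoly.span B"
    using cpoly.maximal_independent_subset by metis
  from B(1) obtain G where G: "G \<subseteq> D" "inj_on (initial_form w') G" "B = initial_form w' ` G"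
    by (metis subset_image_inj)
  have "cpoly.span (initial_form w' ` D) \<subseteq> cpoly.span B"
    using B(3) cpoly.span_minimal cpoly.subspace_span by blast
  then have "V \<subseteq> cpoly.span G"
    using assms G by (intro subset_span_if_initial_forms_in_span[of V S G w']) auto
  then obtain T r where T: "finite T" "T \<subseteq> G" "f = (\<Sum>g\<in>T. cscale (r g) g)"
    using \<open>f \<in> V\<close> unfolding cpoly.span_explicit by blast
  \<comment> \<open>Zero coefficients must go, so that the minimum \<open>m\<close> below comes from
    elements that really contribute.\<close>
  define T' where "T' = {g\<in>T. r g \<noteq> 0}"
  have T': "finite T'" "T' \<subseteq> G" "f = (\<Sum>g\<in>T'. cscale (r g) g)"
    using T by (auto simp: T'_def intro!: sum.mono_neutral_right)
  have nz: "g \<noteq> 0" if "g \<in> G" for g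
    using that B(2) G(3) by (metis cpoly.dependent_zero imageI initial_form_0)
  define K where "K = (\<Union>g\<in>T'. weight w ` Poly_Mapping.keys g)"
  define m where "m = Min K"
  have "T' \<noteq> {}" using T' False by auto
  then have K: "finite K" "K \<noteq> {}" using T' nz by (auto simp: K_def)
  have m_le: "m \<le> weight w u" if "g \<in> T'" "u \<in> Poly_Mapping.keys g" for g u
    using that K(1) unfolding m_def by (intro Min_le) (auto simp: K_def)
  obtain g0 u0 where g0: "g0 \<in> T'" "u0 \<in> Poly_Mapping.keys g0" "weight w u0 = m"
    using Min_in[OF K] by (auto simp: m_def K_def)
  define T0 where "T0 = {g\<in>T'. weight_part w m g \<noteq> 0}"
  have "Poly_Mapping.lookup (weight_part w m g0) u0 \<noteq> 0" using g0 by (simp add: in_keys_iff)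
  then have "g0 \<in> T0" using g0(1) unfolding T0_def by (metis (mono_tags) lookup_zero mem_Collect_eq)
  have init: "weight_part w m g = initial_form w g" if "g \<in> T0" for g
    using that m_le by (intro initial_form_eq_weight_part[symmetric]) (auto simp: T0_def)
  have "weight_part w m f = (\<Sum>g\<in>T'. cscale (r g) (weight_part w m g))"
    unfolding T'(3) by (simp add: weight_part_sum weight_part_cscale)
  also have "\<dots> = (\<Sum>g\<in>T0. cscale (r g) (weight_part w m g))"
    using T'(1) by (auto simp: T0_def intro!: sum.mono_neutral_right)
  also have "\<dots> = (\<Sum>g\<in>T0. cscale (r g) (initial_form w g))"
    by (simp add: init)
  finally have part: "weight_part w m f = (\<Sum>g\<in>T0. cscale (r g) (initial_form w g))" .
  have T0: "finite T0" "T0 \<subseteq> G" "T0 \<subseteq> D" using T' G by (auto simp: T0_def)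
  have "weight_part w m f \<noteq> 0"
  proof
    \<comment> \<open>On \<open>T0\<close> the initial forms at \<open>w\<close> and
      \<open>w'\<close> agree, so a vanishing sum is a linear relation in the independent set
      \<open>B\<close> with the nonzero coefficient \<open>r g0\<close>.\<close>
    assume 0: "weight_part w m f = 0"
    have inj: "inj_on (initial_form w') T0" using G(2) T0(2) inj_on_subset by blast
    have "(\<Sum>b\<in>initial_form w' ` T0. cscale (r (the_inv_into T0 (initial_form w') b)) b)
        = (\<Sum>g\<in>T0. cscale (r g) (initial_form w' g))"
      using inj by (simp add: sum.reindex the_inv_into_f_f)
    also have "\<dots> = 0" unfolding 0[symmetric] part using eq T0(3) by (intro sum.cong) auto
    finally have "r (the_inv_into T0 (initial_form w') (initial_form w' g0)) = 0"
      using cpoly.independentD[OF B(2), of "initial_form w' ` T0"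
        "\<lambda>b. r (the_inv_into T0 (initial_form w') b)"] T0 G(3) \<open>g0 \<in> T0\<close> by blast
    then show False using inj \<open>g0 \<in> T0\<close> by (simp add: the_inv_into_f_f T0_def T'_def)
  qed
  moreover have "\<forall>u\<in>Poly_Mapping.keys f. m \<le> weight w u"
  proof
    fix u assume "u \<in> Poly_Mapping.keys f"
    then have "(\<Sum>g\<in>T'. r g * Poly_Mapping.lookup g u) \<noteq> 0"
      by (simp add: T'(3) in_keys_iff lookup_sum)
    then obtain g where "g \<in> T'" "r g * Poly_Mapping.lookup g u \<noteq> 0"
      by (meson sum.not_neutral_contains_not_neutral)
    then show "m \<le> weight w u" using m_le by (simp add: in_keys_iff)
  qed
  ultimately have "initial_form w f = weight_part w m f" by (simp add: initial_form_eq_weight_part)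
  also have "\<dots> \<in> cpoly.span (initial_form w ` D)"
    unfolding part using T0(3)
    by (intro cpoly.span_sum cpoly.span_scale) (auto intro: cpoly.span_base)
  finally show ?thesis .
qed

subsection \<open>Degree-filtered ideals and the ascending chain condition\<close>

definition total_degree :: "('n::finite \<Rightarrow>\<^sub>0 nat) \<Rightarrow> nat"
  where "total_degree u = (\<Sum>i\<in>UNIV. Poly_Mapping.lookup u i)"

definition exps_upto :: "nat \<Rightarrow> ('n::finite \<Rightarrow>\<^sub>0 nat) set"
  where "exps_upto d = {u. total_degree u \<le> d}"

lemma total_degree_add: "total_degree (u + v) = total_degree u + total_degree v"
  by (simp add: total_degree_def lookup_add sum.distrib)

lemma finite_exps_upto [simp]: "finite (exps_upto d :: ('n::finite \<Rightarrow>\<^sub>0 nat) set)"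
proof (rule finite_imageD)
  have "Poly_Mapping.lookup u i \<le> d" if "u \<in> exps_upto d" for u :: "'n \<Rightarrow>\<^sub>0 nat" and i
    using that member_le_sum[of i UNIV "Poly_Mapping.lookup u"]
    by (simp add: exps_upto_def total_degree_def)
  then have "Poly_Mapping.lookup ` (exps_upto d :: ('n \<Rightarrow>\<^sub>0 nat) set) \<subseteq> PiE UNIV (\<lambda>_. {..d})"
    by (auto simp only: PiE_UNIV_domain Pi_iff atMost_iff)
  moreover have "finite (PiE (UNIV :: 'n set) (\<lambda>_. {..d}))"
    by (rule finite_PiE) simp_all
  ultimately show "finite (Poly_Mapping.lookup ` (exps_upto d :: ('n \<Rightarrow>\<^sub>0 nat) set))"
    by (rule finite_subset)
  show "inj_on Poly_Mapping.lookup (exps_upto d :: ('n \<Rightarrow>\<^sub>0 nat) set)"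
    by (meson inj_onI poly_mapping_eq_iff)
qed

lemma keys_subset_exps_upto: "\<exists>d. Poly_Mapping.keys f \<subseteq> exps_upto d"
proof
  show "Poly_Mapping.keys f \<subseteq> exps_upto (\<Sum>u\<in>Poly_Mapping.keys f. total_degree u)"
    using member_le_sum[of _ "Poly_Mapping.keys f" total_degree] by (simp add: exps_upto_def subsetI)
qed

lemma keys_single_times_subset:
  fixes f :: "'n::finite cpoly"
  assumes "Poly_Mapping.keys f \<subseteq> exps_upto d"
  shows "Poly_Mapping.keys (Poly_Mapping.single v 1 * f) \<subseteq> exps_upto (d + total_degree v + e)"
proof
  fix k assume "k \<in> Poly_Mapping.keys (Poly_Mapping.single v 1 * f)"
  then obtain u where "k = v + u" "u \<in> Poly_Mapping.keys f"
    using keys_mult[of "Poly_Mapping.single v 1" f] by auto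
  then show "k \<in> exps_upto (d + total_degree v + e)"
    using assms by (auto simp: exps_upto_def total_degree_add)
qed

lemma subspace_keys_subset: "cpoly.subspace {f. Poly_Mapping.keys f \<subseteq> S}"
proof (rule cpoly.subspaceI)
  fix f g :: "'a cpoly" and c
  assume f: "f \<in> {f. Poly_Mapping.keys f \<subseteq> S}"
  have "Poly_Mapping.keys (cscale c f) \<subseteq> Poly_Mapping.keys f"
    by (auto simp: in_keys_iff)
  then show "cscale c f \<in> {f. Poly_Mapping.keys f \<subseteq> S}"
    using f by simp
  assume "g \<in> {f. Poly_Mapping.keys f \<subseteq> S}"
  then have "Poly_Mapping.keys f \<union> Poly_Mapping.keys g \<subseteq> S"
    using f by simp
  then show "f + g \<in> {f. Poly_Mapping.keys f \<subseteq> S}"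
    by (intro CollectI order_trans[OF keys_add[of f g]])
qed simp

text \<open>Ties between distinct exponents confine \<open>w\<close> to countably many hyperplanes,
  whose union is negligible.\<close>

lemma exists_generic_weight: "\<exists>w :: real ^ 'n::finite. inj (weight w)"
proof -
  let ?E = "UNIV :: ('n \<Rightarrow>\<^sub>0 nat) set"
  have "?E = (\<Union>d. exps_upto d)" by (auto simp: exps_upto_def)
  moreover have "countable (\<Union>d. exps_upto d :: ('n \<Rightarrow>\<^sub>0 nat) set)"
    by (intro countable_UN) (auto intro: countable_finite)
  ultimately have "countable ?E" by simp
  then have "countable {p \<in> ?E \<times> ?E. fst p \<noteq> snd p}"
    by (intro countable_subset[OF _ countable_SIGMA[of ?E "\<lambda>_. ?E"]]) auto
  moreover have "negligible {w :: real ^ 'n. weight w u = weight w v}" if "u \<noteq> v" for u v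
  proof -
    let ?a = "(\<chi> i. real (Poly_Mapping.lookup u i)) - (\<chi> i. real (Poly_Mapping.lookup v i))"
    have "?a \<noteq> 0" using that by (auto simp: vec_eq_iff intro: poly_mapping_eqI)
    then have "negligible {w. ?a \<bullet> w = 0}" using negligible_hyperplane by blast
    moreover have "{w. weight w u = weight w v} = {w. ?a \<bullet> w = 0}"
      unfolding weight_def inner_diff_left by (simp add: inner_commute)
    ultimately show ?thesis by metis
  qed
  ultimately have "negligible (\<Union>p\<in>{p \<in> ?E \<times> ?E. fst p \<noteq> snd p}.
      {w :: real ^ 'n. weight w (fst p) = weight w (snd p)})"
    by (intro negligible_countable_Union) (auto simp: countable_image)
  then have "(\<Union>p\<in>{p \<in> ?E \<times> ?E. fst p \<noteq> snd p}.
      {w :: real ^ 'n. weight w (fst p) = weight w (snd p)}) \<noteq> UNIV"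
    by (rule contrapos_pn) simp
  then obtain w :: "real ^ 'n" where "w \<notin> (\<Union>p\<in>{p \<in> ?E \<times> ?E. fst p \<noteq> snd p}.
      {w. weight w (fst p) = weight w (snd p)})"
    by blast
  then have "inj (weight w)" unfolding inj_def by fastforce
  then show ?thesis ..
qed

lemma initial_form_generic:
  assumes "inj (weight w)" "f \<noteq> 0"
  obtains u c where "c \<noteq> 0" "initial_form w f = Poly_Mapping.single u c"
proof -
  obtain m where m: "weight_part w m f \<noteq> 0" "initial_form w f = weight_part w m f"
    using minimal_weight_part[OF assms(2)] by metis
  then obtain u where u: "weight w u = m" "Poly_Mapping.lookup f u \<noteq> 0"
    by (metis lookup_weight_part lookup_zero poly_mapping_eqI)
  have "weight_part w m f = Poly_Mapping.single u (Poly_Mapping.lookup f u)"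
    using u(1) assms(1)
    by (intro poly_mapping_eqI) (auto simp: lookup_single when_def dest: injD)
  then show thesis using that u m by metis
qed

section \<open>Dickson's lemma in the form of monotone subsequences\<close>

lemma nat_seq_mono_subseq:
  fixes s :: "nat \<Rightarrow> nat"
  obtains r :: "nat \<Rightarrow> nat" where "strict_mono r" "mono (\<lambda>n. s (r n))"
proof -
  \<comment> \<open>\<open>r\<close> runs through positions whose value bounds all later values from
    below; a minimum over any tail is attained at such a position.\<close>
  have "\<exists>r. \<forall>n. (\<forall>k\<ge>r n. s (r n) \<le> s k) \<and> r n < r (Suc n)"
  proof (rule dependent_nat_choice)
    have *: "\<exists>x\<ge>N. \<forall>k\<ge>x. s x \<le> s k" for N
      using ex_has_least_nat[of "\<lambda>x. N \<le> x" N s] by (auto intro: order_trans)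
    show "\<exists>x. \<forall>k\<ge>x. s x \<le> s k" using * by blast
    show "\<exists>y. (\<forall>k\<ge>y. s y \<le> s k) \<and> x < y" for x using *[of "Suc x"] by (auto simp: Suc_le_eq)
  qed
  then obtain r where r: "\<And>n k. r n \<le> k \<Longrightarrow> s (r n) \<le> s k" "\<And>n. r n < r (Suc n)" by blast
  have "strict_mono r" using r(2) by (simp add: strict_mono_Suc_iff)
  moreover have "mono (\<lambda>n. s (r n))"
    using r by (auto simp: mono_iff_le_Suc intro: less_imp_le)
  ultimately show thesis by (rule that)
qed

text \<open>One thinning per coordinate; monotonicity gained earlier survives further
  thinning.\<close>

lemma dickson_mono_subseq:
  fixes a :: "nat \<Rightarrow> 'k \<Rightarrow> nat"
  assumes "finite K"
  shows "\<exists>r :: nat \<Rightarrow> nat. strict_mono r \<and> (\<forall>k\<in>K. mono (\<lambda>n. a (r n) k))"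
  using assms
proof (induct K)
  case empty
  show ?case by (intro exI[of _ "\<lambda>n. n"]) (simp add: strict_mono_def)
next
  case (insert k K)
  then obtain r :: "nat \<Rightarrow> nat" where r: "strict_mono r" "\<forall>k\<in>K. mono (\<lambda>n. a (r n) k)"
    by blast
  obtain q :: "nat \<Rightarrow> nat" where q: "strict_mono q" "mono (\<lambda>n. a (r (q n)) k)"
    using nat_seq_mono_subseq[of "\<lambda>n. a (r n) k"] by auto
  have "mono (\<lambda>n. a (r (q n)) k')" if "k' \<in> K" for k'
    using r(2) that strict_mono_mono[OF q(1)] by (auto simp: mono_def)
  then have "strict_mono (r \<circ> q) \<and> (\<forall>k'\<in>insert k K. mono (\<lambda>n. a ((r \<circ> q) n) k'))"
    using q r(1) by (auto simp: strict_mono_o)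
  then show ?case by blast
qed

text \<open>
  The family \<open>C\<close> encodes the homogeneous ideal \<open>\<Oplus>\<^sub>d C\<^sub>d\<close> in one more variable, where \<open>f \<in> C d\<close> stands
  for its homogenization of degree \<open>d\<close>; the shift by \<open>e\<close> is multiplication by a power of the
  homogenizing variable.
\<close>

definition filtered_ideal :: "(nat \<Rightarrow> 'n::finite cpoly set) \<Rightarrow> bool"
  where "filtered_ideal C \<longleftrightarrow>
    (\<forall>d. cpoly.subspace (C d) \<and> (\<forall>f\<in>C d. Poly_Mapping.keys f \<subseteq> exps_upto d)) \<and>
    (\<forall>d v e. \<forall>f\<in>C d. Poly_Mapping.single v 1 * f \<in> C (d + total_degree v + e))"

lemma filtered_idealD:
  assumes "filtered_ideal C"
  shows "cpoly.subspace (C d)" "f \<in> C d \<Longrightarrow> Poly_Mapping.keys f \<subseteq> exps_upto d"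
    "f \<in> C d \<Longrightarrow> Poly_Mapping.single v 1 * f \<in> C (d + total_degree v + e)"
  using assms unfolding filtered_ideal_def by blast+

text \<open>
  A generic weight serves as a monomial order: the initial forms are monomials, and a strictly
  ascending chain would yield an infinite sequence of them contradicting Dickson's lemma.
\<close>

lemma filtered_ideal_ACC:
  fixes C :: "nat \<Rightarrow> nat \<Rightarrow> 'n::finite cpoly set"
  assumes C: "\<And>n. filtered_ideal (C n)" and sub: "\<And>n d. C n d \<subseteq> C (Suc n) d"
  shows "\<exists>n. C (Suc n) = C n"
proof (rule ccontr)
  assume contr: "\<nexists>n. C (Suc n) = C n"
  have mono: "C i d \<subseteq> C j d" if "i \<le> j" for i j d
    using that sub by (induct rule: dec_induct) auto
  obtain w :: "real ^ 'n" where w: "inj (weight w)" using exists_generic_weight by blast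
  have "\<exists>d u f c. f \<in> C (Suc n) d \<and> initial_form w f = Poly_Mapping.single u c \<and> c \<noteq> 0 \<and>
      Poly_Mapping.single u c \<notin> cpoly.span (initial_form w ` C n d)" for n
  proof -
    obtain d where d: "C (Suc n) d \<noteq> C n d" using contr by (metis ext)
    have "cpoly.span (C n d) = C n d" using filtered_idealD(1)[OF C] by simp
    then have "\<not> C (Suc n) d \<subseteq> cpoly.span (C n d)" using d sub by blast
    \<comment> \<open>If all initial forms of the larger space lay in the span of those of the
      smaller one, division would make the spaces equal.\<close>
    then obtain f where f: "f \<in> C (Suc n) d" "initial_form w f \<notin> cpoly.span (initial_form w ` C n d)"
      using subset_span_if_initial_forms_in_span[of "C (Suc n) d" "exps_upto d" "C n d" w]
        filtered_idealD[OF C[of "Suc n"]] sub by (meson finite_exps_upto)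
    then have "f \<noteq> 0" by (auto simp: cpoly.span_zero)
    obtain u c where "c \<noteq> 0" "initial_form w f = Poly_Mapping.single u c"
      using w \<open>f \<noteq> 0\<close> by (rule initial_form_generic)
    then show ?thesis using f by auto
  qed
  then obtain D U f c where *: "\<And>n. f n \<in> C (Suc n) (D n)"
    "\<And>n. initial_form w (f n) = Poly_Mapping.single (U n) (c n)" "\<And>n. c n \<noteq> 0"
    "\<And>n. Poly_Mapping.single (U n) (c n) \<notin> cpoly.span (initial_form w ` C n (D n))"
    by metis
  have deg: "total_degree (U n) \<le> D n" for n
  proof -
    have "U n \<in> Poly_Mapping.keys (initial_form w (f n))" using * by simp
    then have "U n \<in> exps_upto (D n)"
      using keys_initial_form filtered_idealD(2)[OF C *(1)] by blast
    then show ?thesis by (simp add: exps_upto_def)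
  qed
  \<comment> \<open>Exponents of the homogenized monomials, with \<open>None\<close> for the
    homogenizing variable; by \<open>deg\<close> the subtraction does not truncate.\<close>
  define a where "a n k = (case k of None \<Rightarrow> D n - total_degree (U n)
    | Some i \<Rightarrow> Poly_Mapping.lookup (U n) i)" for n and k :: "'n option"
  obtain r :: "nat \<Rightarrow> nat" where r: "strict_mono r" "\<forall>k\<in>UNIV. mono (\<lambda>n. a (r n) k)"
    using dickson_mono_subseq[of UNIV a] by auto
  define i j where "i = r 0" and "j = r 1"
  have ij: "i < j" using r(1) by (simp add: i_def j_def strict_mono_less)
  have a: "a i k \<le> a j k" for k using r(2) by (auto simp: i_def j_def mono_def)
  have le: "Poly_Mapping.lookup (U i) k \<le> Poly_Mapping.lookup (U j) k" for k
    using a[of "Some k"] by (simp add: a_def)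
  define v where "v = U j - U i"
  have v: "v + U i = U j"
    using le by (intro poly_mapping_eqI) (simp add: v_def lookup_add lookup_minus)
  then have tv: "total_degree v + total_degree (U i) = total_degree (U j)"
    by (metis total_degree_add)
  \<comment> \<open>The missing power of the homogenizing variable; coordinate \<open>None\<close>
    of \<open>a\<close> keeps this subtraction from truncating.\<close>
  define e where "e = D j - (D i + total_degree v)"
  have e: "D j = D i + total_degree v + e"
    using a[of None] deg[of i] deg[of j] tv by (simp add: e_def a_def)
  \<comment> \<open>\<open>f i\<close> is known to lie at index \<open>Suc i\<close>, which
    \<open>i < j\<close> still puts at or below \<open>j\<close>.\<close>
  have "f i \<in> C j (D i)" using *(1)[of i] mono[of "Suc i" j] ij by auto
  then have "Poly_Mapping.single v 1 * f i \<in> C j (D j)"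
    using filtered_idealD(3)[OF C] e by metis
  moreover have "initial_form w (Poly_Mapping.single v 1 * f i) = Poly_Mapping.single (U j) (c i)"
    using * by (simp add: initial_form_single_times mult_single v)
  ultimately have "Poly_Mapping.single (U j) (c i) \<in> cpoly.span (initial_form w ` C j (D j))"
    by (metis cpoly.span_base imageI)
  then have "cscale (c j / c i) (Poly_Mapping.single (U j) (c i))
      \<in> cpoly.span (initial_form w ` C j (D j))"
    by (rule cpoly.span_scale)
  then show False using * by (simp add: mult_single)
qed

section \<open>Degree truncations of ideals and the Hilbert basis theorem\<close>

lemma filtered_ideal_of_ideal:
  assumes "is_ideal I"
  shows "filtered_ideal (\<lambda>d. {f \<in> I. Poly_Mapping.keys f \<subseteq> exps_upto d})"
proof -
  have "cpoly.subspace I"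
    using assms by (intro cpoly.subspaceI) (auto simp: is_ideal_iff)
  then have "cpoly.subspace (I \<inter> {f. Poly_Mapping.keys f \<subseteq> exps_upto d})" for d
    using subspace_keys_subset by (rule cpoly.subspace_inter)
  then have "cpoly.subspace {f \<in> I. Poly_Mapping.keys f \<subseteq> exps_upto d}" for d
    by (simp add: Collect_conj_eq)
  moreover have "Poly_Mapping.single v 1 * f
      \<in> {f \<in> I. Poly_Mapping.keys f \<subseteq> exps_upto (d + total_degree v + e)}"
    if "f \<in> {f \<in> I. Poly_Mapping.keys f \<subseteq> exps_upto d}" for d v e f
    using that assms keys_single_times_subset[of f d v e] by (simp add: is_ideal_iff)
  ultimately show ?thesis
    unfolding filtered_ideal_def by blast
qed

lemma is_ideal_generated: "is_ideal (ideal_generated_by F)"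
  unfolding is_ideal_def ideal_generated_by_def
  by (rule module.subspace_span[OF module_times])

lemma generators_in_ideal: "F \<subseteq> ideal_generated_by F"
  unfolding ideal_generated_by_def by (rule module.span_superset[OF module_times])

lemma ideal_generated_minimal: "F \<subseteq> I \<Longrightarrow> is_ideal I \<Longrightarrow> ideal_generated_by F \<subseteq> I"
  unfolding ideal_generated_by_def is_ideal_def by (rule module.span_minimal[OF module_times])

text \<open>Otherwise adjoining generators forever gives a strictly growing chain of ideals. Each
  new generator already shows in some degree truncation, against the chain condition.\<close>

theorem hilbert_basis:
  fixes I :: "'n::finite cpoly set"
  assumes "is_ideal I"
  shows "\<exists>F. finite F \<and> F \<subseteq> I \<and> ideal_generated_by F = I"
proof (rule ccontr)
  assume contr: "\<not> ?thesis"
  have "\<exists>F. \<forall>n. (finite (F n) \<and> F n \<subseteq> I) \<and>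
    (F n \<subseteq> F (Suc n) \<and> \<not> F (Suc n) \<subseteq> ideal_generated_by (F n))"
  proof (rule dependent_nat_choice)
    show "\<exists>F. finite F \<and> F \<subseteq> I" by (intro exI[of _ "{}"]) simp
    fix F assume F: "finite F \<and> F \<subseteq> I"
    then have "ideal_generated_by F \<noteq> I" using contr by blast
    moreover have "ideal_generated_by F \<subseteq> I" using F assms by (simp add: ideal_generated_minimal)
    ultimately obtain f where "f \<in> I" "f \<notin> ideal_generated_by F" by blast
    then show "\<exists>F'. (finite F' \<and> F' \<subseteq> I) \<and> (F \<subseteq> F' \<and> \<not> F' \<subseteq> ideal_generated_by F)"
      using F by (intro exI[of _ "insert f F"]) (simp add: subset_insertI)
  qed
  then obtain F where "\<forall>n. (finite (F n) \<and> F n \<subseteq> I) \<and>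
    (F n \<subseteq> F (Suc n) \<and> \<not> F (Suc n) \<subseteq> ideal_generated_by (F n))"
    by (rule exE)
  then have F: "F n \<subseteq> F (Suc n)" "\<not> F (Suc n) \<subseteq> ideal_generated_by (F n)" for n
    by simp_all
  let ?C = "\<lambda>n d. {f \<in> ideal_generated_by (F n). Poly_Mapping.keys f \<subseteq> exps_upto d}"
  have "\<exists>n. ?C (Suc n) = ?C n"
  proof (rule filtered_ideal_ACC[of ?C])
    show "filtered_ideal (?C n)" for n
      by (intro filtered_ideal_of_ideal is_ideal_generated)
    have "ideal_generated_by (F n) \<subseteq> ideal_generated_by (F (Suc n))" for n
      using F(1)[of n] generators_in_ideal[of "F (Suc n)"]
      by (intro ideal_generated_minimal is_ideal_generated) simp
    then show "?C n d \<subseteq> ?C (Suc n) d" for n d by blast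
  qed
  then obtain n where n: "?C (Suc n) = ?C n" by blast
  obtain f where f: "f \<in> F (Suc n)" "f \<notin> ideal_generated_by (F n)" using F(2) by blast
  obtain d where "Poly_Mapping.keys f \<subseteq> exps_upto d" using keys_subset_exps_upto[of f] by blast
  then have "f \<in> ?C (Suc n) d" using f(1) generators_in_ideal[of "F (Suc n)"] by blast
  also have "?C (Suc n) d = ?C n d" using n by (rule fun_cong)
  finally show False using f(2) by blast
qed

subsection \<open>Finite covers of the complement of the tropical variety\<close>

text \<open>The negation is the badness of the overview.\<close>

definition covered :: "'n::finite cpoly set \<Rightarrow> (real ^ 'n) set \<Rightarrow> bool"
  where "covered I W \<longleftrightarrow> (\<exists>F. finite F \<and> F \<subseteq> I \<and>
    W \<inter> (\<Inter>f\<in>F. tropical_hypersurface f) \<subseteq> tropical_variety I)"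

lemma covered_empty [simp]: "covered I {}"
  unfolding covered_def by blast

text \<open>The union of the finitely many witness sets works for all fibres; read backwards, a bad
  set has a bad fibre.\<close>

lemma covered_by_fibres:
  assumes "finite (p ` W)" and "\<And>w. w \<in> W \<Longrightarrow> covered I {w'\<in>W. p w' = p w}"
  shows "covered I W"
proof -
  have "\<forall>c\<in>p ` W. covered I {w'\<in>W. p w' = c}" using assms(2) by blast
  then obtain F where F: "\<forall>c\<in>p ` W. finite (F c) \<and> F c \<subseteq> I \<and>
      {w'\<in>W. p w' = c} \<inter> (\<Inter>f\<in>F c. tropical_hypersurface f) \<subseteq> tropical_variety I"
    unfolding covered_def by (rule bchoice[THEN exE])
  have "W \<inter> (\<Inter>f\<in>\<Union>c\<in>p ` W. F c. tropical_hypersurface f) \<subseteq> tropical_variety I"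
  proof
    fix w assume w: "w \<in> W \<inter> (\<Inter>f\<in>\<Union>c\<in>p ` W. F c. tropical_hypersurface f)"
    then have "w \<in> {w'\<in>W. p w' = p w} \<inter> (\<Inter>f\<in>F (p w). tropical_hypersurface f)" by blast
    then show "w \<in> tropical_variety I" using F w by blast
  qed
  moreover have "finite (\<Union>c\<in>p ` W. F c)" "(\<Union>c\<in>p ` W. F c) \<subseteq> I"
    using F assms(1) by blast+
  ultimately show ?thesis unfolding covered_def by blast
qed

section \<open>Weight orders up to a degree, and initial forms constant on a set of weights\<close>

definition weight_pattern :: "nat \<Rightarrow> real ^ 'n::finite \<Rightarrow> (('n \<Rightarrow>\<^sub>0 nat) \<times> ('n \<Rightarrow>\<^sub>0 nat)) set"
  where "weight_pattern d w = {(u, v) \<in> exps_upto d \<times> exps_upto d. weight w u \<le> weight w v}"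

lemma finite_weight_patterns: "finite (weight_pattern d ` W)"
proof (rule finite_subset)
  show "weight_pattern d ` W \<subseteq> Pow (exps_upto d \<times> exps_upto d)" by (auto simp: weight_pattern_def)
qed simp

lemma initial_form_cong_pattern:
  assumes "weight_pattern d w = weight_pattern d w'" "Poly_Mapping.keys f \<subseteq> exps_upto d"
  shows "initial_form w f = initial_form w' f"
proof -
  have "weight w u \<le> weight w v \<longleftrightarrow> weight w' u \<le> weight w' v"
    if "u \<in> exps_upto d" "v \<in> exps_upto d" for u v
    using that assms(1) by (auto simp: weight_pattern_def set_eq_iff)
  then show ?thesis
    using assms(2) by (intro poly_mapping_eqI) (auto simp: lookup_initial_form in_keys_iff subset_iff)
qed

definition stable_polys ::
    "'n::finite cpoly set \<Rightarrow> (real ^ 'n) set \<Rightarrow> nat \<Rightarrow> 'n cpoly set"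
  where "stable_polys I W d = {f \<in> I. Poly_Mapping.keys f \<subseteq> exps_upto d \<and>
    (\<forall>w\<in>W. \<forall>w'\<in>W. initial_form w f = initial_form w' f)}"

text \<open>This is \<open>J\<^sub>d(W)\<close>. The union avoids choosing a base point: all weights
  in \<open>W\<close> contribute the same set.\<close>

definition stable_initial_ideal ::
    "'n::finite cpoly set \<Rightarrow> (real ^ 'n) set \<Rightarrow> nat \<Rightarrow> 'n cpoly set"
  where "stable_initial_ideal I W d = cpoly.span (\<Union>w\<in>W. initial_form w ` stable_polys I W d)"

lemma initial_form_stable:
  assumes "f \<in> stable_polys I W d" "w \<in> W" "w' \<in> W"
  shows "initial_form w f = initial_form w' f"
  using assms unfolding stable_polys_def by blast

lemma stable_initial_ideal_eq:
  assumes "w \<in> W"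
  shows "stable_initial_ideal I W d = cpoly.span (initial_form w ` stable_polys I W d)"
proof -
  have "initial_form w' ` stable_polys I W d = initial_form w ` stable_polys I W d" if "w' \<in> W" for w'
    using that assms by (intro image_cong refl initial_form_stable)
  then have "(\<Union>w\<in>W. initial_form w ` stable_polys I W d) = initial_form w ` stable_polys I W d"
    using assms by blast
  then show ?thesis by (simp add: stable_initial_ideal_def)
qed

lemma filtered_stable_initial_ideal:
  fixes I :: "'n::finite cpoly set"
  assumes I: "is_ideal I" and "w \<in> W"
  shows "filtered_ideal (stable_initial_ideal I W)"
proof -
  have keys: "Poly_Mapping.keys f \<subseteq> exps_upto d" if "f \<in> stable_initial_ideal I W d" for f d
  proof -
    have "stable_initial_ideal I W d \<subseteq> {f. Poly_Mapping.keys f \<subseteq> exps_upto d}"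
      unfolding stable_initial_ideal_def
      by (intro cpoly.span_minimal subspace_keys_subset)
        (use keys_initial_form in \<open>unfold stable_polys_def, blast\<close>)
    then show ?thesis using that by blast
  qed
  have "Poly_Mapping.single v 1 * f \<in> stable_initial_ideal I W (d + total_degree v + e)"
    if "f \<in> stable_initial_ideal I W d" for f d v e
    using that unfolding stable_initial_ideal_eq[OF \<open>w \<in> W\<close>]
  proof (induct rule: cpoly.span_induct_alt)
    case base
    show ?case by (simp add: cpoly.span_zero)
  next
    case (step c x y)
    then obtain g where g: "g \<in> stable_polys I W d" "x = initial_form w g" by blast
    \<comment> \<open>Multiplication by a monomial commutes with taking initial forms, so constancy
      on \<open>W\<close> passes to the multiple.\<close>
    have "initial_form w (Poly_Mapping.single v 1 * g) = initial_form w' (Poly_Mapping.single v 1 * g)"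
      if "w \<in> W" "w' \<in> W" for w w'
      unfolding initial_form_single_times initial_form_stable[OF g(1) that] by (rule refl)
    then have "Poly_Mapping.single v 1 * g \<in> stable_polys I W (d + total_degree v + e)"
      using g(1) I keys_single_times_subset[of g d v e]
      unfolding stable_polys_def is_ideal_iff by blast
    then have "Poly_Mapping.single v 1 * x
        \<in> cpoly.span (initial_form w ` stable_polys I W (d + total_degree v + e))"
      unfolding g(2) initial_form_single_times[symmetric] by (intro cpoly.span_base imageI)
    then have "cscale c (Poly_Mapping.single v 1 * x) + Poly_Mapping.single v 1 * y
        \<in> cpoly.span (initial_form w ` stable_polys I W (d + total_degree v + e))"
      using step(2) by (intro cpoly.span_add cpoly.span_scale)
    then show ?case by (simp add: algebra_simps)
  qed
  moreover have "cpoly.subspace (stable_initial_ideal I W d)" for d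
    by (simp add: stable_initial_ideal_def)
  ultimately show ?thesis using keys by (simp add: filtered_ideal_def)
qed

text \<open>Fewer weights impose fewer constancy conditions, and a point of \<open>W'\<close> serves
  to compute both spans.\<close>

lemma stable_initial_ideal_antimono:
  assumes "W' \<subseteq> W" "W' \<noteq> {}"
  shows "stable_initial_ideal I W d \<subseteq> stable_initial_ideal I W' d"
proof -
  obtain w where w: "w \<in> W'" "w \<in> W" using assms by blast
  have "stable_polys I W d \<subseteq> stable_polys I W' d"
    using assms(1) unfolding stable_polys_def by blast
  then show ?thesis
    unfolding stable_initial_ideal_eq[OF w(1)] stable_initial_ideal_eq[OF w(2)]
    by (intro cpoly.span_mono image_mono)
qed

lemma covered_UNIV:
  fixes I :: "'n::finite cpoly set"
  assumes I: "is_ideal I"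
  shows "covered I UNIV"
proof (rule ccontr)
  assume contr: "\<not> covered I UNIV"
  have "\<exists>W. \<not> covered I W \<and>
    (\<forall>W'\<subseteq>W. \<not> covered I W' \<longrightarrow> stable_initial_ideal I W' = stable_initial_ideal I W)"
  \<comment> \<open>Otherwise bad sets could be shrunk forever, the spans changing each time, giving
    an ascending chain that never stabilises.\<close>
  proof (rule ccontr)
    assume no: "\<not> ?thesis"
    have "\<exists>W. \<forall>n. \<not> covered I (W n) \<and> (W (Suc n) \<subseteq> W n \<and>
        stable_initial_ideal I (W (Suc n)) \<noteq> stable_initial_ideal I (W n))"
    proof (rule dependent_nat_choice)
      show "\<exists>W. \<not> covered I W" using contr by blast
      show "\<exists>W'. \<not> covered I W' \<and> (W' \<subseteq> W \<and> stable_initial_ideal I W' \<noteq> stable_initial_ideal I W)"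
        if "\<not> covered I W" for W using no that by blast
    qed
    then obtain W where "\<forall>n. \<not> covered I (W n) \<and> (W (Suc n) \<subseteq> W n \<and>
        stable_initial_ideal I (W (Suc n)) \<noteq> stable_initial_ideal I (W n))"
      by (rule exE)
    then have W: "\<not> covered I (W n)" "W (Suc n) \<subseteq> W n"
      "stable_initial_ideal I (W (Suc n)) \<noteq> stable_initial_ideal I (W n)" for n by simp_all
    have ne: "W n \<noteq> {}" for n using W(1)[of n] by auto
    have "\<exists>n. stable_initial_ideal I (W (Suc n)) = stable_initial_ideal I (W n)"
    proof (rule filtered_ideal_ACC[of "\<lambda>n. stable_initial_ideal I (W n)"])
      show "filtered_ideal (stable_initial_ideal I (W n))" for n
        using ne[of n] filtered_stable_initial_ideal[OF I] by blast
      show "stable_initial_ideal I (W n) d \<subseteq> stable_initial_ideal I (W (Suc n)) d" for n d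
        by (rule stable_initial_ideal_antimono[OF W(2) ne])
    qed
    then show False using W(3) by simp
  qed
  then obtain W where W: "\<not> covered I W" and stable: "\<And>W'. W' \<subseteq> W \<Longrightarrow> \<not> covered I W' \<Longrightarrow>
      stable_initial_ideal I W' = stable_initial_ideal I W" by blast
  \<comment> \<open>Otherwise the empty set of witnesses would cover \<open>W\<close>.\<close>
  from W have "\<not> W \<subseteq> tropical_variety I" unfolding covered_def by blast
  then obtain w1 f u c where w1: "w1 \<in> W" "f \<in> I" "c \<noteq> 0"
    "initial_form w1 f = Poly_Mapping.single u c"
    by (auto simp: tropical_variety_def tropical_hypersurface_def is_monomial_def)
  obtain d where d: "Poly_Mapping.keys f \<subseteq> exps_upto d" using keys_subset_exps_upto[of f] by blast
  \<comment> \<open>\<open>w1\<close> need not lie in the bad fibre of \<open>w0\<close>, so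
    \<open>f\<close> may have another initial form there; the spans carry the monomial
    across.\<close>
  obtain w0 where w0: "w0 \<in> W" "\<not> covered I {w\<in>W. weight_pattern d w = weight_pattern d w0}"
    using covered_by_fibres[OF finite_weight_patterns] W by blast
  define Z where "Z = {w\<in>W. weight_pattern d w = weight_pattern d w0}"
  have Z: "w0 \<in> Z" "Z \<subseteq> W" "\<not> covered I Z" using w0 by (auto simp: Z_def)
  define V where "V = {f \<in> I. Poly_Mapping.keys f \<subseteq> exps_upto d}"
  have cong: "initial_form w g = initial_form w0 g" if "w \<in> Z" "g \<in> V" for w g
    using that by (intro initial_form_cong_pattern[of d]) (auto simp: Z_def V_def)
  then have "initial_form w g = initial_form w' g" if "w \<in> Z" "w' \<in> Z" "g \<in> V" for w w' g
    using that by metis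
  then have "V = stable_polys I Z d" unfolding V_def stable_polys_def by blast
  then have "cpoly.span (initial_form w0 ` V) = stable_initial_ideal I W d"
    using stable_initial_ideal_eq[OF Z(1)] stable[OF Z(2,3)] by metis
  then have ini: "cpoly.span (initial_form w0 ` V) = cpoly.span (initial_form w0 ` stable_polys I W d)"
    using stable_initial_ideal_eq[OF w0(1)] by metis
  have V: "cpoly.subspace V" "\<forall>f\<in>V. Poly_Mapping.keys f \<subseteq> exps_upto d"
    using filtered_ideal_of_ideal[OF I] by (auto simp: V_def filtered_ideal_def)
  have D: "stable_polys I W d \<subseteq> V" by (auto simp: stable_polys_def V_def)
  have eq: "\<forall>f\<in>stable_polys I W d. initial_form w1 f = initial_form w0 f"
    using initial_form_stable[OF _ w1(1) w0(1)] by blast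
  \<comment> \<open>By \<open>ini\<close>, the stable polynomials account for all initial forms of
    \<open>V\<close> at \<open>w0\<close>; the transfer moves this to \<open>w1\<close>.\<close>
  have "initial_form w1 f \<in> cpoly.span (initial_form w1 ` stable_polys I W d)"
    using ini w1 d by (intro initial_form_in_span_transfer[OF V _ D eq])
      (auto simp: V_def intro: cpoly.span_base)
  then have "initial_form w1 f \<in> cpoly.span (initial_form w0 ` V)"
    using ini stable_initial_ideal_eq w0(1) w1(1) by metis
  \<comment> \<open>Being a single term, the monomial is its own component of weight
    \<open>weight w0 u\<close>, so one \<open>h\<close> in \<open>V\<close> attains it as initial
    form.\<close>
  from lift_initial_form_span[OF this, of "weight w0 u"] obtain h where
    h: "h \<in> cpoly.span V" "\<forall>k\<in>Poly_Mapping.keys h. weight w0 u \<le> weight w0 k"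
      "weight_part w0 (weight w0 u) h = weight_part w0 (weight w0 u) (Poly_Mapping.single u c)"
    using w1(4) by auto
  have "weight_part w0 (weight w0 u) (Poly_Mapping.single u c) = Poly_Mapping.single u c"
    by (rule poly_mapping_eqI) (simp add: lookup_single when_def)
  moreover have "Poly_Mapping.single u c \<noteq> 0"
    using w1(3) by (metis lookup_single_eq lookup_zero)
  ultimately have h0: "initial_form w0 h = Poly_Mapping.single u c"
    using h initial_form_eq_weight_part by metis
  have "h \<in> V" using h(1) V(1) by (metis cpoly.span_eq_iff)
  then have "initial_form w h = Poly_Mapping.single u c" if "w \<in> Z" for w
    using cong[OF that] h0 by simp
  then have "Z \<inter> (\<Inter>f\<in>{h}. tropical_hypersurface f) = {}"
    using w1(3) by (auto simp: tropical_hypersurface_def is_monomial_def)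
  then have "covered I Z"
    unfolding covered_def using \<open>h \<in> V\<close> V_def by (intro exI[of _ "{h}"]) auto
  then show False using Z(3) by blast
qed

theorem theorem2p9:
  fixes I :: "'n::finite cpoly set"
  assumes "is_ideal I"
  shows "\<exists>F. is_tropical_basis F I"
proof -
  obtain F where F: "finite F" "F \<subseteq> I" "ideal_generated_by F = I"
    using hilbert_basis[OF assms] by blast
  obtain F' where F': "finite F'" "F' \<subseteq> I"
    "(\<Inter>f\<in>F'. tropical_hypersurface f) \<subseteq> tropical_variety I"
    using covered_UNIV[OF assms] by (auto simp: covered_def)
  \<comment> \<open>\<open>F\<close> secures generation and \<open>F'\<close> the tropical variety;
    both lie in \<open>I\<close>, so joining them spoils neither.\<close>
  have "ideal_generated_by F \<subseteq> ideal_generated_by (F \<union> F')"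
    using generators_in_ideal[of "F \<union> F'"] by (intro ideal_generated_minimal is_ideal_generated) simp
  moreover have "ideal_generated_by (F \<union> F') \<subseteq> I"
    using F F' assms by (simp add: ideal_generated_minimal)
  ultimately have "ideal_generated_by (F \<union> F') = I"
    using F by simp
  moreover have "tropical_variety I = (\<Inter>f\<in>F \<union> F'. tropical_hypersurface f)"
    using F(2) F' by (auto simp: tropical_variety_def)
  ultimately have "is_tropical_basis (F \<union> F') I"
    using F(1) F'(1) by (simp add: is_tropical_basis_def)
  then show ?thesis ..
qed

end
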